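(* Let $X$ be a finite set with $|X|=n$, and let $a\in\mathcal T_X$ be an idempotent with $r=\operatorname{rank}(a)$, where $1<r<n$. Let $A_1,\dots,A_r$ be the $\ker(a)$-classes and $\lambda_i=|A_i|$. Then $$|\operatorname{Reg}(\mathcal T_X^a)|=\sum_{m=1}^r m!\,m^{n-r}S(r,m)\sum_{I\in\binom{\mathbf r}{m}}\Lambda_I.$$
   Context: $\mathcal T_X$ is the full transformation semigroup of all maps $X\to X$ under composition; maps are written on the right and composed from left to right; $\operatorname{rank}(f)=|\operatorname{im}(f)|$ and $\ker(f)=\{(x,y):xf=yf\}$. The variant $\mathcal T_X^a$ is the semigroup with underlying set $\mathcal T_X$ and operation $f\star g=fag$; $\operatorname{Reg}(\mathcal T_X^a)$ is its set of regular elements ($x$ is regular if $x=x\star y\star x$ and $y=y\star x\star y$ for some $y$). $\mathbf r=\{1,\dots,r\}$; $\binom{\mathbf r}{m}$ is the set of $m$-element subsets of $\mathbf r$; $\Lambda_I=\prod_{i\in I}\lambda_i$; $S(r,m)$ is the Stirling number of the second kind. *)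

theory Defs
  imports "HOL-Library.FuncSet" "HOL-Combinatorics.Stirling"
begin

text \<open>Maps of \<open>X\<close> to itself are taken extensional (\<open>undefined\<close> off \<open>X\<close>), so that HOL functions
  correspond one-to-one to maps and cardinalities are the intended ones.\<close>

definition full_transformations :: "'a set \<Rightarrow> ('a \<Rightarrow> 'a) set" where
  "full_transformations X = X \<rightarrow>\<^sub>E X"

text \<open>Maps act on the right: the product \<open>fg\<close> applies \<open>f\<close> first.\<close>

definition tprod :: "'a set \<Rightarrow> ('a \<Rightarrow> 'a) \<Rightarrow> ('a \<Rightarrow> 'a) \<Rightarrow> ('a \<Rightarrow> 'a)" where
  "tprod X f g = compose X g f"

definition map_rank :: "'a set \<Rightarrow> ('a \<Rightarrow> 'a) \<Rightarrow> nat" where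
  "map_rank X f = card (f ` X)"

definition map_ker :: "'a set \<Rightarrow> ('a \<Rightarrow> 'a) \<Rightarrow> ('a \<times> 'a) set" where
  "map_ker X f = {(x, y). x \<in> X \<and> y \<in> X \<and> f x = f y}"

definition variant_prod :: "'a set \<Rightarrow> ('a \<Rightarrow> 'a) \<Rightarrow> ('a \<Rightarrow> 'a) \<Rightarrow> ('a \<Rightarrow> 'a) \<Rightarrow> ('a \<Rightarrow> 'a)" where
  "variant_prod X a f g = tprod X (tprod X f a) g"

definition regular_elements :: "'s set \<Rightarrow> ('s \<Rightarrow> 's \<Rightarrow> 's) \<Rightarrow> 's set" where
  "regular_elements S mul =
     {x \<in> S. \<exists>y\<in>S. x = mul (mul x y) x \<and> y = mul (mul y x) y}"

definition Reg_variant :: "'a set \<Rightarrow> ('a \<Rightarrow> 'a) \<Rightarrow> ('a \<Rightarrow> 'a) set" where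
  "Reg_variant X a = regular_elements (full_transformations X) (variant_prod X a)"

end

theory Submission
  imports Defs
begin

text \<open>Read as ordinary functions, regularity of \<open>x\<close> in the variant says that
  \<open>x \<circ> a \<circ> y \<circ> a \<circ> x = x\<close> for some \<open>y\<close>; the second regularity equation is then obtained for
  free by changing \<open>y\<close>. This holds if and only if \<open>a\<close> is injective on the image
  \<open>B\<close> of \<open>x\<close> and \<open>x\<close> already attains all of \<open>B\<close> on the image \<open>a ` X\<close>
  (\<open>Reg_variant_eq\<close>). For a fixed \<open>B\<close> with \<open>m\<close> elements, such an \<open>x\<close> is a surjection
  \<open>a ` X \<rightarrow> B\<close> together with an arbitrary map \<open>X - a ` X \<rightarrow> B\<close>, which gives
  \<open>m! S(r, m) m\<^sup>n\<^sup>-\<^sup>r\<close> possibilities (\<open>card_maps_fixed_image\<close>). Finally, the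
  sets \<open>B\<close> on which \<open>a\<close> is injective are the partial transversals of the kernel classes:
  \<open>B\<close> is obtained by choosing the set \<open>I\<close> of indices of the classes that it meets, and one point
  in each of these classes, so that \<open>\<Prod>i\<in>I. card (A i)\<close> of them belong to \<open>I\<close>
  (\<open>card_transversals\<close>).\<close>

section \<open>Counting surjections\<close>

text \<open>By induction on the domain: a surjection \<open>f\<close> from \<open>insert a A\<close> onto \<open>B\<close> restricts on \<open>A\<close> to a
  surjection onto \<open>B\<close> or onto \<open>B - {f a}\<close>, which matches the recurrence of the Stirling
  numbers.\<close>

lemma card_surjections:
  assumes "finite A" "finite B"
  shows "card {f \<in> A \<rightarrow>\<^sub>E B. f ` A = B} = fact (card B) * Stirling (card A) (card B)"
  using assms
proof (induction A arbitrary: B rule: finite_induct)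
  case empty
  show ?case
  proof (cases "B = {}")
    case True
    then show ?thesis by simp
  next
    case False
    with empty obtain k where "card B = Suc k"
      by (metis card_eq_0_iff not0_implies_Suc)
    with False show ?thesis by auto
  qed
next
  case (insert a A)
  let ?S = "\<lambda>A B. {f \<in> A \<rightarrow>\<^sub>E B. f ` A = B}"
  show ?case
  proof (cases "B = {}")
    case True
    then show ?thesis using insert by simp
  next
    case False
    then obtain k where k: "card B = Suc k"
      using insert.prems by (metis card_eq_0_iff not0_implies_Suc)
    let ?T = "\<lambda>b. ?S A B \<union> ?S A (B - {b})"
    have fin: "finite (?S A B')" if "finite B'" for B'
      using that insert.hyps by (simp add: finite_PiE)
    have "bij_betw (\<lambda>(b, g). g(a := b)) (Sigma B ?T) (?S (insert a A) B)"
    proof (rule bij_betw_byWitness[where f' = "\<lambda>f. (f a, f(a := undefined))"])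
      show "\<forall>p \<in> Sigma B ?T.
          (\<lambda>f. (f a, f(a := undefined))) ((\<lambda>(b, g). g(a := b)) p) = p"
      proof
        fix p assume "p \<in> Sigma B ?T"
        then obtain b g where p: "p = (b, g)" and "g \<in> ?T b" by blast
        then have "g a = undefined"
          using insert.hyps by (auto simp: PiE_def extensional_def)
        then have "g(a := undefined) = g" by (rule fun_upd_idem)
        then show "(\<lambda>f. (f a, f(a := undefined))) ((\<lambda>(b, g). g(a := b)) p) = p"
          by (simp add: p)
      qed
      show "\<forall>f \<in> ?S (insert a A) B.
          (\<lambda>(b, g). g(a := b)) ((\<lambda>f. (f a, f(a := undefined))) f) = f"
        by auto
      show "(\<lambda>(b, g). g(a := b)) ` Sigma B ?T \<subseteq> ?S (insert a A) B"
      proof (rule image_subsetI)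
        fix p assume p: "p \<in> Sigma B ?T"
        obtain b g where bg: "p = (b, g)" by (cases p)
        with p have b: "b \<in> B" and T: "g \<in> ?T b" by auto
        have "A \<rightarrow>\<^sub>E B - {b} \<subseteq> A \<rightarrow>\<^sub>E B" by (rule PiE_mono) auto
        with T have g: "g \<in> A \<rightarrow>\<^sub>E B" "g ` A = B \<or> g ` A = B - {b}" by blast+
        have "(g(a := b)) ` A = g ` A"
          using insert.hyps by auto
        then have "(g(a := b)) ` insert a A = B"
          using b g by auto
        moreover have "g(a := b) \<in> insert a A \<rightarrow>\<^sub>E B"
          using b g by (auto simp: PiE_def extensional_def)
        ultimately show "(\<lambda>(b, g). g(a := b)) p \<in> ?S (insert a A) B"
          using bg by (simp del: image_insert)
      qed
      show "(\<lambda>f. (f a, f(a := undefined))) ` ?S (insert a A) B \<subseteq> Sigma B ?T"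
      proof (rule image_subsetI)
        fix f assume "f \<in> ?S (insert a A) B"
        then have f: "f \<in> insert a A \<rightarrow>\<^sub>E B" "f ` insert a A = B" by auto
        let ?g = "f(a := undefined)"
        have im: "?g ` A = f ` A" using insert.hyps by auto
        have ext: "?g \<in> extensional A" using f(1) by (auto simp: PiE_def extensional_def)
        have "f ` A = B \<or> f ` A = B - {f a}"
          unfolding f(2)[symmetric] image_insert by blast
        have "?g \<in> ?T (f a)"
        proof -
          have "?g \<in> A \<rightarrow>\<^sub>E ?g ` A" using ext by (simp add: PiE_def)
          then show ?thesis using im \<open>f ` A = B \<or> f ` A = B - {f a}\<close>
            by (elim disjE) (simp_all only: Un_iff mem_Collect_eq simp_thms)
        qed
        moreover have "f a \<in> B" using f(2) by auto
        ultimately show "(f a, ?g) \<in> Sigma B ?T" by simp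
      qed
    qed
    then have "card (?S (insert a A) B) = card (Sigma B ?T)"
      by (rule bij_betw_same_card[symmetric])
    also have "card (Sigma B ?T) = (\<Sum>b\<in>B. card (?T b))"
      using insert.prems fin by (intro card_SigmaI) auto
    also have "\<dots> = (\<Sum>b\<in>B. fact (Suc k) * Stirling (card A) (Suc k)
                              + fact k * Stirling (card A) k)"
    proof (rule sum.cong[OF refl])
      fix b assume b: "b \<in> B"
      have "?S A B \<inter> ?S A (B - {b}) = {}" using b by auto
      then have "card (?T b) = card (?S A B) + card (?S A (B - {b}))"
        using insert.prems fin by (intro card_Un_disjoint) auto
      then show "card (?T b) = fact (Suc k) * Stirling (card A) (Suc k)
                              + fact k * Stirling (card A) k"
        using insert.IH[of B] insert.IH[of "B - {b}"] insert.prems b k by simp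
    qed
    also have "\<dots> = fact (card B) * Stirling (card (insert a A)) (card B)"
      using insert.hyps by (simp add: k algebra_simps)
    finally show ?thesis .
  qed
qed

section \<open>Regular elements of a variant\<close>

text \<open>Necessity is immediate from \<open>x \<circ> a \<circ> y \<circ> a \<circ> x = x\<close>. Conversely, injectivity lets \<open>y\<close>
  recover \<open>x z\<close> from \<open>a (x z)\<close>, and the condition on images then supplies a point of \<open>a ` X\<close> that
  \<open>x\<close> maps to \<open>x z\<close>.\<close>

lemma Reg_variant_eq:
  assumes a: "a \<in> full_transformations X"
  shows "Reg_variant X a = {x \<in> X \<rightarrow>\<^sub>E X. inj_on a (x ` X) \<and> x ` (a ` X) = x ` X}"
proof -
  have aX: "a z \<in> X" if "z \<in> X" for z
    using a that by (auto simp: full_transformations_def)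
  show ?thesis
  proof (intro set_eqI iffI)
    fix x
    assume "x \<in> Reg_variant X a"
    then obtain y where x: "x \<in> X \<rightarrow>\<^sub>E X" and y: "y \<in> X \<rightarrow>\<^sub>E X"
      and "x = variant_prod X a (variant_prod X a x y) x"
      by (auto simp: Reg_variant_def regular_elements_def full_transformations_def)
    then have xyx: "x z = x (a (y (a (x z))))" if "z \<in> X" for z
      using that by (metis (no_types, lifting) compose_eq tprod_def variant_prod_def)
    have "inj_on a (x ` X)"
    proof (rule inj_onI, clarify)
      fix z w assume "z \<in> X" "w \<in> X" "a (x z) = a (x w)"
      then show "x z = x w" using xyx[of z] xyx[of w] by simp
    qed
    moreover have "x ` (a ` X) = x ` X"
    proof
      show "x ` (a ` X) \<subseteq> x ` X" using aX by auto
      show "x ` X \<subseteq> x ` (a ` X)"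
      proof (rule image_subsetI)
        fix z assume z: "z \<in> X"
        have "y (a (x z)) \<in> X" using z x y aX by (auto simp: PiE_def Pi_def)
        then show "x z \<in> x ` (a ` X)" using xyx[OF z] by blast
      qed
    qed
    ultimately show "x \<in> {x \<in> X \<rightarrow>\<^sub>E X. inj_on a (x ` X) \<and> x ` (a ` X) = x ` X}"
      using x by simp
  next
    fix x
    assume "x \<in> {x \<in> X \<rightarrow>\<^sub>E X. inj_on a (x ` X) \<and> x ` (a ` X) = x ` X}"
    then have x: "x \<in> X \<rightarrow>\<^sub>E X" and inj: "inj_on a (x ` X)" and im: "x ` (a ` X) = x ` X"
      by auto
    have xX: "x z \<in> X" if "z \<in> X" for z using x that by auto
    have "\<forall>z\<in>X. \<exists>u. u \<in> X \<and> x (a u) = x z"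
    proof
      fix z assume "z \<in> X"
      then have "x z \<in> x ` (a ` X)" using im by simp
      then show "\<exists>u. u \<in> X \<and> x (a u) = x z" by auto
    qed
    then obtain s where "\<forall>z\<in>X. s z \<in> X \<and> x (a (s z)) = x z"
      using bchoice[of X "\<lambda>z u. u \<in> X \<and> x (a u) = x z"] by blast
    then have s: "s z \<in> X" "x (a (s z)) = x z" if "z \<in> X" for z
      using that by auto
    \<comment> \<open>The map \<open>y0\<close> sends \<open>a (x z)\<close> to a point \<open>u\<close> with \<open>x (a u) = x z\<close>; its values
      outside \<open>a ` x ` X\<close> are irrelevant. It satisfies the first regularity equation.\<close>
    define y0 where "y0 w = (if w \<in> a ` x ` X then s (inv_into X (a \<circ> x) w) else w)" for w
    have y0X: "y0 w \<in> X" if "w \<in> X" for w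
    proof (cases "w \<in> a ` x ` X")
      case True
      then have "inv_into X (a \<circ> x) w \<in> X" by (intro inv_into_into) (simp add: image_comp)
      then show ?thesis using True s by (simp add: y0_def)
    next
      case False
      then show ?thesis using that unfolding y0_def by (simp only: if_False)
    qed
    have y0: "x (a (y0 (a (x z)))) = x z" if z: "z \<in> X" for z
    proof -
      let ?v = "inv_into X (a \<circ> x) (a (x z))"
      have m: "a (x z) \<in> (a \<circ> x) ` X" using z by auto
      have v: "?v \<in> X" using inv_into_into[OF m] .
      have "a (x ?v) = a (x z)" using f_inv_into_f[OF m] by simp
      then have "x ?v = x z" using inj v z by (auto dest: inj_onD)
      then show ?thesis using s[OF v] z by (auto simp: y0_def)
    qed
    \<comment> \<open>A solution \<open>y0\<close> of the first equation yields a solution of both, the product of \<open>y0\<close>, \<open>x\<close>,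
      \<open>y0\<close> in the variant.\<close>
    define y where "y = restrict (\<lambda>w. y0 (a (x (a (y0 w))))) X"
    have "y \<in> X \<rightarrow>\<^sub>E X"
      unfolding y_def using y0X aX xX by auto
    moreover have "x = variant_prod X a (variant_prod X a x y) x"
      using x y0 y0X aX xX
      by (intro extensionalityI[where A = X])
        (auto simp: PiE_def variant_prod_def tprod_def compose_def y_def)
    moreover have "y = variant_prod X a (variant_prod X a y x) y"
      using y0 y0X aX xX
      by (intro extensionalityI[where A = X])
        (auto simp: PiE_def variant_prod_def tprod_def compose_def y_def)
    ultimately show "x \<in> Reg_variant X a"
      using x by (auto simp: Reg_variant_def regular_elements_def full_transformations_def)
  qed
qed

text \<open>Such a map amounts to a surjection \<open>R \<rightarrow> B\<close> on \<open>R\<close> and an arbitrary map to \<open>B\<close> elsewhere.\<close>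

lemma card_maps_fixed_image:
  assumes fin: "finite X" and R: "R \<subseteq> X" and B: "B \<subseteq> X"
  shows "card {x \<in> X \<rightarrow>\<^sub>E X. x ` X = B \<and> x ` R = B} =
    fact (card B) * Stirling (card R) (card B) * card B ^ (card X - card R)"
proof -
  let ?M = "{x \<in> X \<rightarrow>\<^sub>E X. x ` X = B \<and> x ` R = B}"
  let ?S = "{f \<in> R \<rightarrow>\<^sub>E B. f ` R = B}"
  let ?D = "(X - R) \<rightarrow>\<^sub>E B"
  let ?glue = "\<lambda>(f, g). restrict (\<lambda>z. if z \<in> R then f z else g z) X"
  have "bij_betw (\<lambda>x. (restrict x R, restrict x (X - R))) ?M (?S \<times> ?D)"
  proof (rule bij_betw_byWitness[where f' = ?glue])
    show "\<forall>x\<in>?M. ?glue (restrict x R, restrict x (X - R)) = x"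
    proof
      fix x assume "x \<in> ?M"
      then have x: "x \<in> extensional X" by (simp add: PiE_def)
      show "?glue (restrict x R, restrict x (X - R)) = x"
        by (rule extensionalityI[OF _ x]) auto
    qed
    show "\<forall>p\<in>?S \<times> ?D. (\<lambda>x. (restrict x R, restrict x (X - R))) (?glue p) = p"
    proof
      fix p assume "p \<in> ?S \<times> ?D"
      then obtain f g where p: "p = (f, g)"
        and f: "f \<in> extensional R" and g: "g \<in> extensional (X - R)"
        by (cases p) (simp add: PiE_def)
      have "restrict (?glue p) R = f"
        by (rule extensionalityI[OF _ f]) (use R in \<open>auto simp: p\<close>)
      moreover have "restrict (?glue p) (X - R) = g"
        by (rule extensionalityI[OF _ g]) (auto simp: p)
      ultimately show "(\<lambda>x. (restrict x R, restrict x (X - R))) (?glue p) = p"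
        by (simp only: p)
    qed
    show "(\<lambda>x. (restrict x R, restrict x (X - R))) ` ?M \<subseteq> ?S \<times> ?D"
      using R by (auto simp: image_restrict_eq)
    show "?glue ` (?S \<times> ?D) \<subseteq> ?M"
    proof (rule image_subsetI)
      fix p assume "p \<in> ?S \<times> ?D"
      then obtain f g where p: "p = (f, g)"
        and f: "f \<in> R \<rightarrow>\<^sub>E B" "f ` R = B" and g: "g \<in> ?D"
        by (cases p) simp
      let ?h = "restrict (\<lambda>z. if z \<in> R then f z else g z) X"
      have val: "?h z \<in> B" if "z \<in> X" for z using that f g by auto
      have hR: "?h ` R = B" using f R by (force simp: image_iff)
      have "?h ` X = B" using val hR R by blast
      moreover have "?h \<in> X \<rightarrow>\<^sub>E X"
        by (rule PiE_I) (use val B in blast, simp)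
      ultimately show "?glue p \<in> ?M"
        using hR by (simp only: p prod.case mem_Collect_eq simp_thms)
    qed
  qed
  then have "card ?M = card (?S \<times> ?D)" by (rule bij_betw_same_card)
  moreover have "finite R" "finite B" using fin R B finite_subset by auto
  ultimately show ?thesis
    using fin R by (simp add: card_cartesian_product card_surjections card_funcsetE card_Diff_subset)
qed

section \<open>Transversals and the number of regular elements\<close>

lemma card_transversals:
  assumes "finite I" and disj: "\<And>i j. i \<in> I \<Longrightarrow> j \<in> I \<Longrightarrow> i \<noteq> j \<Longrightarrow> A i \<inter> A j = {}"
  shows "card ((\<lambda>f. f ` I) ` Pi\<^sub>E I A) = (\<Prod>i\<in>I. card (A i))"
proof -
  have "inj_on (\<lambda>f. f ` I) (Pi\<^sub>E I A)"
  proof (rule inj_onI)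
    fix f g assume f: "f \<in> Pi\<^sub>E I A" and g: "g \<in> Pi\<^sub>E I A" and eq: "f ` I = g ` I"
    show "f = g"
    proof (rule PiE_ext[OF f g])
      fix i assume i: "i \<in> I"
      then obtain j where j: "j \<in> I" "f i = g j" using eq by blast
      then have "f i \<in> A i \<inter> A j" using f g i by (metis IntI PiE_mem)
      then show "f i = g i" using disj[of i j] i j by auto
    qed
  qed
  then show ?thesis using assms(1) by (simp add: card_image card_PiE)
qed

theorem corollary5p9:
  fixes X :: "'a set" and a :: "'a \<Rightarrow> 'a" and n r :: nat
    and A :: "nat \<Rightarrow> 'a set" and lam :: "nat \<Rightarrow> nat"
  assumes "finite X" and "card X = n"
    and "a \<in> full_transformations X" and "tprod X a a = a"
    and "r = map_rank X a" and "1 < r" and "r < n"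
    and "bij_betw A {1..r} (X // map_ker X a)"
    and "\<And>i. i \<in> {1..r} \<Longrightarrow> lam i = card (A i)"
  shows "card (Reg_variant X a) =
    (\<Sum>m = 1..r. fact m * m ^ (n - r) * Stirling r m *
       (\<Sum>I\<in>{I. I \<subseteq> {1..r} \<and> card I = m}. \<Prod>i\<in>I. lam i))"
proof -
  have aX: "a z \<in> X" if "z \<in> X" for z
    using assms(3) that by (auto simp: full_transformations_def)
  have eqv: "equiv X (map_ker X a)"
    by (rule equivI) (auto simp: map_ker_def refl_on_def sym_def trans_def)
  have Aq: "A i \<in> X // map_ker X a" if "i \<in> {1..r}" for i
    using assms(8) that by (auto simp: bij_betw_def)
  have AX: "A i \<subseteq> X" if "i \<in> {1..r}" for i
    using Aq[OF that] eqv by (metis Union_quotient Union_upper)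
  have cover: "\<exists>i\<in>{1..r}. z \<in> A i" if "z \<in> X" for z
  proof -
    have "\<Union> (A ` {1..r}) = X"
      using assms(8) Union_quotient[OF eqv] by (simp add: bij_betw_def)
    then show ?thesis using that by blast
  qed
  have sep: "a z = a w \<longleftrightarrow> i = j"
    if "i \<in> {1..r}" "j \<in> {1..r}" "z \<in> A i" "w \<in> A j" for i j z w
  proof -
    have "i = j \<longleftrightarrow> A i = A j"
      using that(1,2) assms(8) by (simp only: bij_betw_def inj_on_eq_iff[of A "{1..r}"])
    also have "\<dots> \<longleftrightarrow> (z, w) \<in> map_ker X a"
      by (rule quotient_eq_iff[OF eqv Aq[OF that(1)] Aq[OF that(2)] that(3,4)])
    also have "\<dots> \<longleftrightarrow> a z = a w"
      using that(3,4) AX[OF that(1)] AX[OF that(2)] by (auto simp: map_ker_def)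
    finally show ?thesis by (rule sym)
  qed
  \<comment> \<open>\<open>T I\<close> consists of the transversals of the classes with index in \<open>I\<close>, and \<open>M B\<close> of the
    regular elements with image \<open>B\<close> whenever \<open>a\<close> is injective on \<open>B\<close>.\<close>
  define T where "T I = (\<lambda>f. f ` I) ` Pi\<^sub>E I A" for I
  define M where "M B = {x \<in> X \<rightarrow>\<^sub>E X. x ` X = B \<and> x ` (a ` X) = B}" for B
  let ?P = "Pow {1..r}"
  have choice: "\<exists>f. B = f ` I \<and> (\<forall>i\<in>I. f i \<in> A i \<and> i \<in> {1..r})"
    if I: "I \<in> ?P" "B \<in> T I" for I B
  proof -
    obtain f where f: "f \<in> Pi\<^sub>E I A" "B = f ` I" using I(2) unfolding T_def by blast
    show ?thesis
      using f I(1) by (intro exI[of _ f]) (blast dest: PiE_mem)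
  qed
  have TX: "B \<subseteq> X" if I: "I \<in> ?P" "B \<in> T I" for I B
    using choice[OF I] AX by blast
  have index_set: "I = {i \<in> {1..r}. A i \<inter> B \<noteq> {}}" if I: "I \<in> ?P" "B \<in> T I" for I B
  proof -
    obtain f where B: "B = f ` I" and f: "\<forall>i\<in>I. f i \<in> A i \<and> i \<in> {1..r}"
      using choice[OF I] by blast
    have "i \<in> I" if "i \<in> {1..r}" "j \<in> I" "f j \<in> A i" for i j
      using sep[of i j "f j" "f j"] that f by blast
    then show ?thesis using B f by blast
  qed
  have cardB: "card B = card I" and injB: "inj_on a B" if I: "I \<in> ?P" "B \<in> T I" for I B
  proof -
    obtain f where B: "B = f ` I" and f: "\<forall>i\<in>I. f i \<in> A i \<and> i \<in> {1..r}"
      using choice[OF I] by blast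
    have *: "i = j" if "i \<in> I" "j \<in> I" "a (f i) = a (f j)" for i j
      using sep[of i j "f i" "f j"] that f by blast
    have "inj_on f I"
      by (rule inj_onI) (simp add: *)
    then show "card B = card I" unfolding B by (rule card_image)
    show "inj_on a B"
      unfolding B by (rule inj_onI) (use * in blast)
  qed
  have finT: "finite (T I)" if "I \<in> ?P" for I
  proof (rule finite_subset)
    show "T I \<subseteq> Pow X" using TX[OF that] by blast
  qed (simp add: assms(1))
  have transversals: "{B. B \<subseteq> X \<and> inj_on a B} = (\<Union>I\<in>?P. T I)"
  proof (intro set_eqI iffI)
    fix B assume "B \<in> {B. B \<subseteq> X \<and> inj_on a B}"
    then have B: "B \<subseteq> X" "inj_on a B" by auto
    define I where "I = {i \<in> {1..r}. A i \<inter> B \<noteq> {}}"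
    define f where "f = restrict (\<lambda>i. SOME z. z \<in> A i \<inter> B) I"
    have f: "f i \<in> A i \<inter> B" if "i \<in> I" for i
      using that some_in_eq[of "A i \<inter> B"] by (auto simp: f_def I_def)
    have "z \<in> f ` I" if z: "z \<in> B" for z
    proof -
      obtain i where i: "i \<in> {1..r}" "z \<in> A i" using cover z B by blast
      then have iI: "i \<in> I" using z by (auto simp: I_def)
      then have "a (f i) = a z" using sep[of i i "f i" z] i f by blast
      then have "f i = z" using B(2) f[OF iI] z by (auto dest: inj_onD)
      then show ?thesis using iI by blast
    qed
    then have "B = f ` I" using f by blast
    moreover have "f \<in> Pi\<^sub>E I A"
      by (rule PiE_I) (use f in blast, simp add: f_def)
    ultimately have "B \<in> T I" by (auto simp: T_def)
    then show "B \<in> (\<Union>I\<in>?P. T I)" by (auto simp: I_def)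
  next
    fix B assume "B \<in> (\<Union>I\<in>?P. T I)"
    then obtain I where I: "I \<in> ?P" "B \<in> T I" by blast
    show "B \<in> {B. B \<subseteq> X \<and> inj_on a B}" using injB[OF I] TX[OF I] by simp
  qed
  have cardM: "card (M B) = fact m * Stirling r m * m ^ (n - r)"
    if "B \<subseteq> X" "m = card B" for B m
    using card_maps_fixed_image[OF assms(1), of "a ` X" B] aX that assms(2,5)
    unfolding M_def map_rank_def by auto
  have "finite (X \<rightarrow>\<^sub>E X)" using assms(1) by (simp add: finite_PiE)
  then have finM: "finite (M B)" for B unfolding M_def by simp
  have "Reg_variant X a = (\<Union>B\<in>{B. B \<subseteq> X \<and> inj_on a B}. M B)"
    unfolding Reg_variant_eq[OF assms(3)] M_def by auto
  then have "card (Reg_variant X a) = (\<Sum>B\<in>{B. B \<subseteq> X \<and> inj_on a B}. card (M B))"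
    using finM assms(1) by (subst card_UN_disjoint[symmetric]) (auto simp: M_def)
  also have "\<dots> = (\<Sum>I\<in>?P. \<Sum>B\<in>T I. card (M B))"
    unfolding transversals
  proof (rule sum.UNION_disjoint)
    show "\<forall>I\<in>?P. \<forall>J\<in>?P. I \<noteq> J \<longrightarrow> T I \<inter> T J = {}"
    proof (intro ballI impI)
      fix I J assume IJ: "I \<in> ?P" "J \<in> ?P" "I \<noteq> J"
      have False if "B \<in> T I" "B \<in> T J" for B
        using index_set[OF IJ(1) that(1)] index_set[OF IJ(2) that(2)] IJ(3) by simp
      then show "T I \<inter> T J = {}" by blast
    qed
    show "\<forall>I\<in>?P. finite (T I)" using finT by blast
  qed simp
  also have "\<dots> = (\<Sum>I\<in>?P. fact (card I) * card I ^ (n - r) * Stirling r (card I) *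
      (\<Prod>i\<in>I. lam i))" (is "_ = sum ?h ?P")
  proof (rule sum.cong[OF refl])
    fix I assume I: "I \<in> ?P"
    have fI: "finite I" using I finite_subset by auto
    have "A i \<inter> A j = {}" if "i \<in> I" "j \<in> I" "i \<noteq> j" for i j
    proof -
      have "i \<in> {1..r}" "j \<in> {1..r}" using that I by auto
      then show ?thesis using sep[of i j] that(3) by blast
    qed
    then have "card (T I) = (\<Prod>i\<in>I. card (A i))"
      unfolding T_def by (intro card_transversals[OF fI]) auto
    also have "\<dots> = (\<Prod>i\<in>I. lam i)"
      using I assms(9) by (intro prod.cong) auto
    finally have cT: "card (T I) = (\<Prod>i\<in>I. lam i)" .
    have "(\<Sum>B\<in>T I. card (M B)) =
        (\<Sum>B\<in>T I. fact (card I) * Stirling r (card I) * card I ^ (n - r))"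
    proof (rule sum.cong[OF refl])
      fix B assume B: "B \<in> T I"
      show "card (M B) = fact (card I) * Stirling r (card I) * card I ^ (n - r)"
        by (rule cardM[OF TX[OF I B] cardB[OF I B, symmetric]])
    qed
    then show "(\<Sum>B\<in>T I. card (M B)) = ?h I" using cT by simp
  qed
  also have "\<dots> = (\<Sum>m\<in>{0..r}. \<Sum>I\<in>{I. I \<in> ?P \<and> card I = m}. ?h I)"
  proof (rule sum.group[symmetric])
    show "card ` ?P \<subseteq> {0..r}" using card_mono[of "{1..r}"] by fastforce
  qed auto
  also have "\<dots> = (\<Sum>m\<in>{0..r}. fact m * m ^ (n - r) * Stirling r m *
       (\<Sum>I\<in>{I. I \<subseteq> {1..r} \<and> card I = m}. \<Prod>i\<in>I. lam i))"
    by (intro sum.cong) (auto simp: sum_distrib_left intro!: sum.cong)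
  also have "\<dots> = (\<Sum>m = 1..r. fact m * m ^ (n - r) * Stirling r m *
       (\<Sum>I\<in>{I. I \<subseteq> {1..r} \<and> card I = m}. \<Prod>i\<in>I. lam i))"
    \<comment> \<open>The term for \<open>m = 0\<close> vanishes because \<open>n - r > 0\<close>.\<close>
    using assms(7) by (simp add: sum.atLeast_Suc_atMost)
  finally show ?thesis .
qed

end
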